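(* Let $n>k\ge 1$ be integers, let $\boldsymbol{X}\in\mathbb{R}^{n\times k}$ have rank $k$, let $\boldsymbol{\Omega}\in\mathbb{R}^{n\times n}$ be symmetric positive definite, and let $\boldsymbol{K}\in\mathbb{R}^{k\times k}$ be symmetric positive semidefinite. Put $$\widetilde{\boldsymbol{\Omega}}=\begin{pmatrix}\boldsymbol{\Omega}&\boldsymbol{0}\\ \boldsymbol{0}&\boldsymbol{I}_k\end{pmatrix}\in\mathbb{R}^{(n+k)\times(n+k)},\qquad \boldsymbol{Z}=\begin{pmatrix}\boldsymbol{X}\\ \boldsymbol{K}\end{pmatrix}\in\mathbb{R}^{(n+k)\times k},\qquad \boldsymbol{P}_Z=\boldsymbol{Z}(\boldsymbol{Z}^\top\boldsymbol{Z})^{-1}\boldsymbol{Z}^\top .$$ Then the equality $\hat{\boldsymbol{\beta}}_{GR}(\boldsymbol{\Omega},\boldsymbol{K})=\hat{\boldsymbol{\beta}}_{GR}(\boldsymbol{I}_n,\boldsymbol{K})$ holds for all $\boldsymbol{y}\in\mathbb{R}^n$ if and only if $$\widetilde{\boldsymbol{\Omega}}\boldsymbol{P}_Z=\boldsymbol{P}_Z\widetilde{\boldsymbol{\Omega}}.$$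
   Context: For a symmetric positive definite $\boldsymbol{\Phi}\in\mathbb{R}^{n\times n}$, a symmetric positive semidefinite $\boldsymbol{K}\in\mathbb{R}^{k\times k}$, and $\boldsymbol{y}\in\mathbb{R}^n$, the general ridge estimator is $$\hat{\boldsymbol{\beta}}_{GR}(\boldsymbol{\Phi},\boldsymbol{K})=(\boldsymbol{X}^\top\boldsymbol{\Phi}^{-1}\boldsymbol{X}+\boldsymbol{K})^{-1}\boldsymbol{X}^\top\boldsymbol{\Phi}^{-1}\boldsymbol{y}\in\mathbb{R}^k .$$ $\boldsymbol{I}_m$ denotes the $m\times m$ identity matrix. All matrices are real. Since $\boldsymbol{X}$ has rank $k$, $\boldsymbol{Z}$ has full column rank, so $\boldsymbol{P}_Z$ is well defined and is the orthogonal projector onto the column space of $\boldsymbol{Z}$. *)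

theory Defs
  imports "HOL-Analysis.Analysis"
begin

definition symmetric_matrix :: "real^'a^'a \<Rightarrow> bool" where
  "symmetric_matrix A \<longleftrightarrow> transpose A = A"

definition sym_pos_def :: "real^'a^'a \<Rightarrow> bool" where
  "sym_pos_def A \<longleftrightarrow> symmetric_matrix A \<and> (\<forall>x. x \<noteq> 0 \<longrightarrow> x \<bullet> (A *v x) > 0)"

definition sym_pos_semidef :: "real^'a^'a \<Rightarrow> bool" where
  "sym_pos_semidef A \<longleftrightarrow> symmetric_matrix A \<and> (\<forall>x. x \<bullet> (A *v x) \<ge> 0)"

definition general_ridge ::
  "real^'k^'n \<Rightarrow> real^'n^'n \<Rightarrow> real^'k^'k \<Rightarrow> real^'n \<Rightarrow> real^'k" where
  "general_ridge X \<Phi> K y =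
     (matrix_inv (transpose X ** matrix_inv \<Phi> ** X + K) ** transpose X ** matrix_inv \<Phi>) *v y"

text \<open>
  Block matrices are indexed by disjoint sums of the index types, \<open>Inl\<close> for the first
  block and \<open>Inr\<close> for the second.
\<close>

definition block_diag :: "real^'a^'a \<Rightarrow> real^'b^'b \<Rightarrow> real^('a + 'b)^('a + 'b)" where
  "block_diag A B =
     (\<chi> i j. case i of
        Inl a \<Rightarrow> (case j of Inl a' \<Rightarrow> A $ a $ a' | Inr _ \<Rightarrow> 0)
      | Inr b \<Rightarrow> (case j of Inl _ \<Rightarrow> 0 | Inr b' \<Rightarrow> B $ b $ b'))"

definition vstack :: "real^'c^'a \<Rightarrow> real^'c^'b \<Rightarrow> real^'c^('a + 'b)" where
  "vstack A B = (\<chi> i j. case i of Inl a \<Rightarrow> A $ a $ j | Inr b \<Rightarrow> B $ b $ j)"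

definition proj_matrix :: "real^'k^'m \<Rightarrow> real^'m^'m" where
  "proj_matrix Z = Z ** matrix_inv (transpose Z ** Z) ** transpose Z"

end

theory Submission
  imports Defs
begin

text \<open>
  Both sides of the equivalence say that the column space of \<open>Z = (X; K)\<close> is invariant under
  \<open>diag(\<Omega>, I)\<close>, that is, that some \<open>N\<close> satisfies \<open>\<Omega> X = X N\<close> and \<open>K = K N\<close>.

  On the projector side this is the familiar fact that a symmetric matrix commutes with an
  orthogonal projector exactly when it preserves its range (\<open>commutes_proj_matrix_iff\<close>).

  On the estimator side, put \<open>A = X\<^sup>T \<Omega>\<^sup>-\<^sup>1 X + K\<close> and \<open>B = X\<^sup>T X + K\<close>, both positive
  definite. After transposition, equality of the two estimators reads \<open>\<Omega>\<^sup>-\<^sup>1 X = X M\<close> with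
  \<open>M = B\<^sup>-\<^sup>1 A\<close>. Substituting this into \<open>A = B M\<close> gives
  \<open>X\<^sup>T X M + K = X\<^sup>T X M + K M\<close>, so \<open>K = K M\<close>: the estimator equation contains the condition
  on \<open>K\<close> as well. Conversely \<open>\<Omega>\<^sup>-\<^sup>1 X = X M\<close> together with \<open>K = K M\<close> forces \<open>A = B M\<close>, which gives
  the estimator equation back (\<open>ridge_coefficients_eq_iff\<close>). Passing from \<open>M\<close> to
  \<open>N = M\<^sup>-\<^sup>1\<close> turns \<open>\<Omega>\<^sup>-\<^sup>1\<close> into \<open>\<Omega>\<close>.
\<close>

section \<open>Positive definiteness and invertibility\<close>

lemma matrix_inv_cancel:
  fixes A :: "real^'a^'a"
  assumes "invertible A"
  shows "A ** matrix_inv A = mat 1" and "matrix_inv A ** A = mat 1"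
  using someI_ex[OF assms[unfolded invertible_def]] by (auto simp: matrix_inv_def)

lemma transpose_add: "transpose (A + B) = transpose A + transpose (B :: real^'a^'b)"
  by (simp add: transpose_def vec_eq_iff)

lemma matrix_add_rdistrib:
  fixes A B :: "real^'a^'b" and C :: "real^'c^'a"
  shows "(A + B) ** C = A ** C + B ** C"
  by (simp add: vec_eq_iff matrix_matrix_mult_def distrib_right sum.distrib)

lemma invertible_of_ker_trivial:
  fixes A :: "real^'a^'a"
  assumes "\<And>x. A *v x = 0 \<Longrightarrow> x = 0"
  shows "invertible A"
  using assms matrix_left_invertible_ker[of A] invertible_left_inverse[of A] by auto

lemma invertible_pos_def:
  assumes "sym_pos_def A"
  shows "invertible A"
proof (rule invertible_of_ker_trivial)
  fix x assume "A *v x = 0"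
  then show "x = 0"
    using assms unfolding sym_pos_def_def by (metis inner_zero_right less_irrefl)
qed

lemma transpose_matrix_inv:
  fixes A :: "real^'a^'a"
  assumes "invertible A"
  shows "transpose (matrix_inv A) = matrix_inv (transpose A)"
proof -
  have "transpose A ** transpose (matrix_inv A) = mat 1"
    by (metis matrix_inv_cancel(2)[OF assms] matrix_transpose_mul transpose_mat)
  moreover have "invertible (transpose A)"
    using assms by (rule transpose_invertible)
  ultimately show ?thesis
    by (metis matrix_inv_cancel(2) matrix_mul_assoc matrix_mul_lid matrix_mul_rid)
qed

lemma sym_pos_def_matrix_inv:
  assumes "sym_pos_def A"
  shows "sym_pos_def (matrix_inv A)"
proof -
  have inv: "invertible A" and sym: "transpose A = A"
    using assms invertible_pos_def by (auto simp: sym_pos_def_def symmetric_matrix_def)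
  have "x \<bullet> (matrix_inv A *v x) > 0" if "x \<noteq> 0" for x
  proof -
    define w where "w = matrix_inv A *v x"
    have x: "x = A *v w"
      by (simp add: w_def matrix_vector_mul_assoc matrix_inv_cancel[OF inv])
    with that have "w \<noteq> 0" by auto
    then have "w \<bullet> (A *v w) > 0" using assms by (simp add: sym_pos_def_def)
    then show ?thesis by (simp add: x[symmetric] w_def[symmetric] inner_commute)
  qed
  then show ?thesis
    by (simp add: sym_pos_def_def symmetric_matrix_def transpose_matrix_inv[OF inv] sym)
qed

lemma inner_congruence:
  fixes X :: "real^'k^'n"
  shows "x \<bullet> ((transpose X ** S ** X) *v x) = (X *v x) \<bullet> (S *v (X *v x))"
proof -
  have "x \<bullet> (transpose X *v z) = (X *v x) \<bullet> z" for z
    using dot_lmul_matrix[of z X x] by (simp add: transpose_matrix_vector inner_commute)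
  then show ?thesis by (simp add: matrix_vector_mul_assoc[symmetric])
qed

lemma sym_pos_def_mat_1: "sym_pos_def (mat 1)"
  by (simp add: sym_pos_def_def symmetric_matrix_def transpose_mat)

text \<open>
  This single lemma covers all Gram-type matrices in the argument: \<open>X\<^sup>T \<Omega>\<^sup>-\<^sup>1 X + K\<close>,
  \<open>X\<^sup>T X + K\<close>, and, with zero in place of \<open>K\<close>, \<open>Z\<^sup>T Z\<close>.
\<close>

lemma sym_pos_def_congruence_add:
  fixes X :: "real^'k^'n"
  assumes S: "sym_pos_def S" and K: "sym_pos_semidef K"
    and X: "\<And>x. X *v x = 0 \<Longrightarrow> x = 0"
  shows "sym_pos_def (transpose X ** S ** X + K)"
proof -
  have "x \<bullet> ((transpose X ** S ** X + K) *v x) > 0" if "x \<noteq> 0" for x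
  proof -
    have "X *v x \<noteq> 0" using X that by blast
    then have "(X *v x) \<bullet> (S *v (X *v x)) > 0"
      using S by (simp add: sym_pos_def_def)
    moreover have "x \<bullet> (K *v x) \<ge> 0"
      using K by (simp add: sym_pos_semidef_def)
    ultimately show ?thesis
      by (simp add: matrix_vector_mult_add_rdistrib inner_add_right inner_congruence)
  qed
  moreover have "transpose (transpose X ** S ** X + K) = transpose X ** S ** X + K"
    using S K by (simp add: sym_pos_def_def sym_pos_semidef_def symmetric_matrix_def
        transpose_add matrix_transpose_mul matrix_mul_assoc)
  ultimately show ?thesis
    by (simp add: sym_pos_def_def symmetric_matrix_def)
qed

section \<open>Commuting with an orthogonal projector\<close>

text \<open>
  The matrix \<open>N\<close> exists exactly when the range of \<open>Z\<close> is invariant under \<open>S\<close>. Given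
  invariance, \<open>P S P = S P\<close>, and transposing this identity swaps the sides of \<open>S\<close>.
\<close>

lemma commutes_proj_matrix_iff:
  fixes Z :: "real^'k^'m" and S :: "real^'m^'m"
  assumes Z: "\<And>x. Z *v x = 0 \<Longrightarrow> x = 0" and S: "transpose S = S"
  shows "S ** proj_matrix Z = proj_matrix Z ** S \<longleftrightarrow> (\<exists>N. S ** Z = Z ** N)"
proof -
  define G where "G = transpose Z ** Z"
  have "sym_pos_semidef (0 :: real^'k^'k)"
    by (simp add: sym_pos_semidef_def symmetric_matrix_def transpose_def vec_eq_iff)
  from sym_pos_def_congruence_add[OF sym_pos_def_mat_1 this Z]
  have "sym_pos_def G" by (simp add: G_def)
  then have inv: "invertible G" and symG: "transpose G = G"
    using invertible_pos_def by (auto simp: sym_pos_def_def symmetric_matrix_def)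
  define P where "P = proj_matrix Z"
  have P: "P = Z ** matrix_inv G ** transpose Z"
    by (simp add: P_def proj_matrix_def G_def)
  have symP: "transpose P = P"
    by (simp add: P matrix_transpose_mul transpose_matrix_inv[OF inv] symG matrix_mul_assoc)
  have PZ: "P ** Z = Z"
  proof -
    have "P ** Z = Z ** (matrix_inv G ** G)"
      by (simp add: P G_def matrix_mul_assoc)
    then show ?thesis by (simp add: matrix_inv_cancel[OF inv])
  qed
  have "\<exists>N. S ** Z = Z ** N" if "S ** P = P ** S"
  proof -
    have "S ** Z = S ** P ** Z" by (simp add: PZ matrix_mul_assoc[symmetric])
    also have "\<dots> = Z ** (matrix_inv G ** transpose Z ** S ** Z)"
      by (simp only: that) (simp add: P matrix_mul_assoc)
    finally show ?thesis by blast
  qed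
  moreover have "S ** P = P ** S" if N: "S ** Z = Z ** N" for N
  proof -
    have SP: "S ** P = Z ** N ** matrix_inv G ** transpose Z"
      by (simp add: P matrix_mul_assoc N)
    \<comment> \<open>The columns of \<open>S P\<close> lie in the range of \<open>Z\<close>, which \<open>P\<close> fixes.\<close>
    have PSP: "P ** S ** P = S ** P"
      by (simp add: matrix_mul_assoc[symmetric] SP) (simp add: matrix_mul_assoc PZ)
    have "transpose (P ** S ** P) = transpose (S ** P)" by (simp only: PSP)
    then have "P ** S ** P = P ** S"
      by (simp add: matrix_transpose_mul S symP matrix_mul_assoc)
    with PSP show ?thesis by simp
  qed
  ultimately show ?thesis unfolding P_def by blast
qed

section \<open>Block matrices\<close>

lemma sum_UNIV_Plus:
  fixes f :: "'a::finite + 'b::finite \<Rightarrow> real"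
  shows "sum f UNIV = (\<Sum>a\<in>UNIV. f (Inl a)) + (\<Sum>b\<in>UNIV. f (Inr b))"
  by (simp add: UNIV_Plus_UNIV[symmetric] sum.Plus del: UNIV_Plus_UNIV)

lemma block_diag_mult_vstack:
  "block_diag A B ** vstack X Y = vstack (A ** X) (B ** Y)"
  by (auto simp: vec_eq_iff block_diag_def vstack_def matrix_matrix_mult_def sum_UNIV_Plus
      split: sum.split)

lemma vstack_mult: "vstack X Y ** N = vstack (X ** N) (Y ** N)"
  by (auto simp: vec_eq_iff vstack_def matrix_matrix_mult_def split: sum.split)

lemma vstack_eq_iff: "vstack A B = vstack C D \<longleftrightarrow> A = C \<and> B = D"
  by (auto simp: vec_eq_iff vstack_def split: sum.splits)

lemma vstack_mult_vector_eq_0D: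
  assumes "vstack X Y *v x = 0"
  shows "X *v x = 0"
proof -
  have "(vstack X Y *v x) $ Inl i = (X *v x) $ i" for i
    by (simp add: vstack_def matrix_vector_mult_def)
  with assms show ?thesis by (simp add: vec_eq_iff)
qed

lemma transpose_block_diag:
  "transpose (block_diag A B) = block_diag (transpose A) (transpose B)"
  by (auto simp: vec_eq_iff block_diag_def transpose_def split: sum.split)

section \<open>Equality of ridge estimators\<close>

text \<open>
  The weight \<open>W\<close> plays the role of \<open>\<Omega>\<^sup>-\<^sup>1\<close>. The coefficient matrices agree iff \<open>W X = X M\<close> for \<open>M = B\<^sup>-\<^sup>1 A\<close>; the condition \<open>K M = K\<close> is
  what makes an arbitrary \<open>M\<close> with \<open>W X = X M\<close> equal to \<open>B\<^sup>-\<^sup>1 A\<close>.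
\<close>

lemma ridge_coefficients_eq_iff:
  fixes X :: "real^'k^'n" and W :: "real^'n^'n" and K :: "real^'k^'k"
  defines "A \<equiv> transpose X ** W ** X + K" and "B \<equiv> transpose X ** X + K"
  assumes invA: "invertible A" and invB: "invertible B"
    and symA: "transpose A = A" and symB: "transpose B = B" and symW: "transpose W = W"
  shows "matrix_inv A ** transpose X ** W = matrix_inv B ** transpose X \<longleftrightarrow>
    (\<exists>M. W ** X = X ** M \<and> K ** M = K)"
proof -
  let ?M = "matrix_inv B ** A"
  have "matrix_inv A ** transpose X ** W = matrix_inv B ** transpose X \<longleftrightarrow>
      transpose X ** W = A ** matrix_inv B ** transpose X"
    by (metis matrix_inv_cancel[OF invA] matrix_mul_assoc matrix_mul_lid)
  also have "\<dots> \<longleftrightarrow>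
      transpose (transpose X ** W) = transpose (A ** matrix_inv B ** transpose X)"
    by (metis transpose_transpose)
  also have "\<dots> \<longleftrightarrow> W ** X = X ** ?M"
    by (simp add: matrix_transpose_mul symW symA transpose_matrix_inv[OF invB] symB)
  also have "\<dots> \<longleftrightarrow> (\<exists>M. W ** X = X ** M \<and> K ** M = K)"
  proof
    assume WX: "W ** X = X ** ?M"
    have "B ** ?M = A"
      by (simp add: matrix_mul_assoc matrix_inv_cancel[OF invB])
    moreover have "B ** ?M = transpose X ** X ** ?M + K ** ?M"
      by (simp add: B_def matrix_add_rdistrib)
    moreover have "A = transpose X ** X ** ?M + K"
    proof -
      have "A = transpose X ** (W ** X) + K" by (simp add: A_def matrix_mul_assoc)
      then show ?thesis by (simp only: WX matrix_mul_assoc)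
    qed
    ultimately have "K ** ?M = K" by (metis add_left_imp_eq)
    with WX show "\<exists>M. W ** X = X ** M \<and> K ** M = K" by blast
  next
    assume "\<exists>M. W ** X = X ** M \<and> K ** M = K"
    then obtain M where M: "W ** X = X ** M" "K ** M = K" by blast
    have "A = B ** M"
      by (simp add: A_def B_def matrix_add_rdistrib M matrix_mul_assoc[symmetric])
    then have "?M = M"
      by (simp add: matrix_mul_assoc matrix_inv_cancel[OF invB])
    with M show "W ** X = X ** ?M" by simp
  qed
  finally show ?thesis .
qed

text \<open>
  Injectivity of \<open>X\<close> makes \<open>M\<close> invertible, and \<open>N = M\<^sup>-\<^sup>1\<close> is then the matrix needed for the
  inverse weight.
\<close>

lemma invariance_inverse:
  fixes X :: "real^'k^'n" and V W :: "real^'n^'n" and K :: "real^'k^'k"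
  assumes X: "\<And>x. X *v x = 0 \<Longrightarrow> x = 0" and VW: "V ** W = mat 1"
    and M: "W ** X = X ** M" "K ** M = K"
  shows "\<exists>N. V ** X = X ** N \<and> K ** N = K"
proof -
  have VXM: "V ** X ** M = X"
  proof -
    have "V ** X ** M = V ** W ** X" by (simp add: matrix_mul_assoc[symmetric] M)
    then show ?thesis by (simp add: VW)
  qed
  have "invertible M"
  proof (rule invertible_of_ker_trivial)
    fix x assume "M *v x = 0"
    then have "(V ** X ** M) *v x = 0"
      by (simp add: matrix_vector_mul_assoc[symmetric])
    then show "x = 0" using X VXM by simp
  qed
  note inv = matrix_inv_cancel[OF this]
  have "V ** X = X ** matrix_inv M"
    by (metis VXM inv(1) matrix_mul_assoc matrix_mul_rid)
  moreover have "K ** matrix_inv M = K"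
    by (metis M(2) inv(1) matrix_mul_assoc matrix_mul_rid)
  ultimately show ?thesis by blast
qed

lemma general_ridge_eq_iff:
  fixes X :: "real^'k^'n" and \<Omega> :: "real^'n^'n" and K :: "real^'k^'k"
  assumes X: "\<And>x. X *v x = 0 \<Longrightarrow> x = 0"
    and \<Omega>: "sym_pos_def \<Omega>" and K: "sym_pos_semidef K"
  shows "(\<forall>y. general_ridge X \<Omega> K y = general_ridge X (mat 1) K y) \<longleftrightarrow>
    (\<exists>N. \<Omega> ** X = X ** N \<and> K ** N = K)"
proof -
  let ?W = "matrix_inv \<Omega>"
  let ?A = "transpose X ** ?W ** X + K" and ?B = "transpose X ** X + K"
  have W: "sym_pos_def ?W" by (rule sym_pos_def_matrix_inv[OF \<Omega>])
  have A: "sym_pos_def ?A" by (rule sym_pos_def_congruence_add[OF W K X])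
  have B: "sym_pos_def ?B"
    using sym_pos_def_congruence_add[OF sym_pos_def_mat_1 K X] by simp
  have inv1: "matrix_inv (mat 1) = (mat 1 :: real^'n^'n)"
    by (metis invertible_pos_def matrix_inv_cancel(1) matrix_mul_lid sym_pos_def_mat_1)
  have "(\<forall>y. general_ridge X \<Omega> K y = general_ridge X (mat 1) K y) \<longleftrightarrow>
      matrix_inv ?A ** transpose X ** ?W = matrix_inv ?B ** transpose X"
    by (simp add: general_ridge_def inv1 matrix_eq)
  also have "\<dots> \<longleftrightarrow> (\<exists>M. ?W ** X = X ** M \<and> K ** M = K)"
    using A B W
    by (intro ridge_coefficients_eq_iff invertible_pos_def)
      (auto simp: sym_pos_def_def symmetric_matrix_def)
  also have "\<dots> \<longleftrightarrow> (\<exists>N. \<Omega> ** X = X ** N \<and> K ** N = K)"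
    using invariance_inverse[OF X, where V = \<Omega> and W = ?W] invariance_inverse[OF X, where V = ?W and W = \<Omega>]
      matrix_inv_cancel[OF invertible_pos_def[OF \<Omega>]] by blast
  finally show ?thesis .
qed

theorem theorem3p1:
  fixes X :: "real^'k^'n" and \<Omega> :: "real^'n^'n" and K :: "real^'k^'k"
  assumes "CARD('k) < CARD('n)"
    and "rank X = CARD('k)"
    and "sym_pos_def \<Omega>"
    and "sym_pos_semidef K"
  shows "(\<forall>y. general_ridge X \<Omega> K y = general_ridge X (mat 1) K y) \<longleftrightarrow>
    block_diag \<Omega> (mat 1 :: real^'k^'k) ** proj_matrix (vstack X K) =
    proj_matrix (vstack X K) ** block_diag \<Omega> (mat 1 :: real^'k^'k)"
proof -
  let ?S = "block_diag \<Omega> (mat 1 :: real^'k^'k)" and ?Z = "vstack X K"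
  have X: "x = 0" if "X *v x = 0" for x
    using that assms(2) full_rank_injective[of X] by (metis injD matrix_vector_mult_0_right)
  have "transpose ?S = ?S"
    using assms(3)
    by (simp add: transpose_block_diag transpose_mat sym_pos_def_def symmetric_matrix_def)
  then have "?S ** proj_matrix ?Z = proj_matrix ?Z ** ?S \<longleftrightarrow> (\<exists>N. ?S ** ?Z = ?Z ** N)"
    by (intro commutes_proj_matrix_iff) (auto dest: vstack_mult_vector_eq_0D X)
  also have "\<dots> \<longleftrightarrow> (\<exists>N. \<Omega> ** X = X ** N \<and> K ** N = K)"
    by (auto simp: block_diag_mult_vstack vstack_mult vstack_eq_iff)
  finally show ?thesis
    using general_ridge_eq_iff[OF X assms(3,4)] by simp
qed

end
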